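(* Let $\kappa_r>0$, $0<\kappa_\varepsilon<1$, and $x^*\in\mathbb{R}^2$. Starting at $t=0$ from any initial unicycle pose $(x(0),\theta(0))\in\mathbb{R}^2\times[-\pi,\pi)$, the unicycle position trajectory $x(t)$ under the adaptive headway controller $u_{x^*}$ satisfies, for all $t\ge0$, $$x(t)\in\begin{cases}\mathrm{conv}(x^*,x(0),x_\varepsilon(0)), & \text{if } o(\theta(0))^{\mathrm T}\frac{x^*-x(0)}{\|x^*-x(0)\|}\ge\kappa_\varepsilon,\\ \mathrm{conv}(x^*,\check{x}(0),\widehat{x}(0)), & \text{otherwise.}\end{cases}$$ Moreover, $\mathrm{conv}(x^*,x(0),x_\varepsilon(0))\subseteq\mathrm{conv}(x^*,\check{x}(0),\widehat{x}(0))$ if $o(\theta(0))^{\mathrm T}\frac{x^*-x(0)}{\|x^*-x(0)\|}\ge\kappa_\varepsilon$; and, for any state $(x,\theta)$, $\widehat{x}=x$ and $\check{x}=x_\varepsilon$ if $o(\theta)^{\mathrm T}\frac{x^*-x}{\|x^*-x\|}=\kappa_\varepsilon$. Here $x_\varepsilon(0),\check{x}(0),\widehat{x}(0)$ are the headway point, projected unicycle position and extended unicycle position associated with $(x(0),\theta(0))$, and $\mathrm{conv}$ denotes the convex hull.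
   Context: Write $o(\theta)=(\cos\theta,\sin\theta)^{\mathrm T}$ and $n(\theta)=(-\sin\theta,\cos\theta)^{\mathrm T}$. A unicycle state is $(x,\theta)$ with $x\in\mathbb{R}^2$, $\theta\in[-\pi,\pi)$ (an angle, understood modulo $2\pi$). Unicycle dynamics: $\dot x=v\,o(\theta)$, $\dot\theta=\omega$. The adaptive headway controller $u_{x^*}=(v_{x^*},\omega_{x^*})$ with gains $\kappa_r>0$, $0<\kappa_\varepsilon<1$ is, for $x\neq x^*$, $$v_{x^*}(x,\theta)=\frac{\kappa_r\|x^*-x\|\left(o(\theta)^{\mathrm T}\frac{x^*-x}{\|x^*-x\|}-\kappa_\varepsilon\right)}{1-\kappa_\varepsilon\, o(\theta)^{\mathrm T}\frac{x^*-x}{\|x^*-x\|}},\qquad \omega_{x^*}(x,\theta)=\frac{\kappa_r}{\kappa_\varepsilon}\,n(\theta)^{\mathrm T}\frac{x^*-x}{\|x^*-x\|},$$ and $v_{x^*}=\omega_{x^*}=0$ when $x=x^*$. Closed-loop trajectories are solutions of $\dot x=v_{x^*}(x,\theta)o(\theta)$, $\dot\theta=\omega_{x^*}(x,\theta)$. For a state $(x,\theta)$: the headway point is $x_\varepsilon=x+\varepsilon\,o(\theta)$ with $\varepsilon=\kappa_\varepsilon\|x-x^*\|$; the headway tangent is $\mathrm{t}_\varepsilon=\frac{x^*-x_\varepsilon}{\|x^*-x_\varepsilon\|}$ if $x_\varepsilon\ne x^*$ and $0$ otherwise; the headway normal is $\mathrm{n}_\varepsilon=R_{\pi/2}\mathrm{t}_\varepsilon$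 if $(x^*-x)^{\mathrm T}n(\theta)\ge0$ and $R_{-\pi/2}\mathrm{t}_\varepsilon$ otherwise, where $R_\phi$ is the counterclockwise rotation matrix by angle $\phi$; the projected unicycle position is $\check{x}=x^*+\mathrm{t}_\varepsilon\mathrm{t}_\varepsilon^{\mathrm T}(x-x^* )$; the extended unicycle position is $\widehat{x}=\check{x}+\frac{\kappa_\varepsilon}{\sqrt{1-\kappa_\varepsilon^2}}\|\check{x}-x^*\|\,\mathrm{n}_\varepsilon$. When $x=x^*$ the quotients in the case conditions are undefined, but then all the points $x,x_\varepsilon,\check{x},\widehat{x}$ equal $x^*$ and both triangles equal $\{x^*\}$. *)

theory Defs
  imports "HOL-Analysis.Analysis"
begin

definition heading :: "real \<Rightarrow> real^2" where
  "heading \<theta> = vector [cos \<theta>, sin \<theta>]"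

definition heading_normal :: "real \<Rightarrow> real^2" where
  "heading_normal \<theta> = vector [- sin \<theta>, cos \<theta>]"

definition rotation2 :: "real \<Rightarrow> real^2^2" where
  "rotation2 \<phi> = vector [vector [cos \<phi>, - sin \<phi>], vector [sin \<phi>, cos \<phi>]]"

(* At x = xs division by zero makes goal_dir xs x = 0. Then heading \<theta> \<bullet> goal_dir xs x = 0,
   which is below every positive gain: the case distinctions below take their "otherwise" branch
   there, where both triangles are {xs}. *)
definition goal_dir :: "real^2 \<Rightarrow> real^2 \<Rightarrow> real^2" where
  "goal_dir xs x = (xs - x) /\<^sub>R norm (xs - x)"

definition linear_velocity :: "real \<Rightarrow> real \<Rightarrow> real^2 \<Rightarrow> real^2 \<Rightarrow> real \<Rightarrow> real" where
  "linear_velocity \<kappa>r \<kappa>e xs x \<theta> =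
     (if x = xs then 0
      else \<kappa>r * norm (xs - x) * (heading \<theta> \<bullet> goal_dir xs x - \<kappa>e)
             / (1 - \<kappa>e * (heading \<theta> \<bullet> goal_dir xs x)))"

definition angular_velocity :: "real \<Rightarrow> real \<Rightarrow> real^2 \<Rightarrow> real^2 \<Rightarrow> real \<Rightarrow> real" where
  "angular_velocity \<kappa>r \<kappa>e xs x \<theta> =
     (if x = xs then 0 else \<kappa>r / \<kappa>e * (heading_normal \<theta> \<bullet> goal_dir xs x))"

(* The orientation is a real-valued lift of the angle modulo 2 * pi: only its initial value is
   confined to [-pi, pi), so that it can vary differentiably. The right-hand sides are
   2 * pi-periodic in it. Derivatives are one-sided at t = 0. *)
definition closed_loop_trajectory ::
    "real \<Rightarrow> real \<Rightarrow> real^2 \<Rightarrow> (real \<Rightarrow> real^2) \<Rightarrow> (real \<Rightarrow> real) \<Rightarrow> bool" where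
  "closed_loop_trajectory \<kappa>r \<kappa>e xs x \<theta> \<longleftrightarrow>
     \<theta> 0 \<in> {-pi..<pi} \<and>
     (\<forall>t\<ge>0.
        (x has_vector_derivative linear_velocity \<kappa>r \<kappa>e xs (x t) (\<theta> t) *\<^sub>R heading (\<theta> t))
          (at t within {0..}) \<and>
        (\<theta> has_real_derivative angular_velocity \<kappa>r \<kappa>e xs (x t) (\<theta> t)) (at t within {0..}))"

definition headway_point :: "real \<Rightarrow> real^2 \<Rightarrow> real^2 \<Rightarrow> real \<Rightarrow> real^2" where
  "headway_point \<kappa>e xs x \<theta> = x + (\<kappa>e * norm (x - xs)) *\<^sub>R heading \<theta>"

definition headway_tangent :: "real \<Rightarrow> real^2 \<Rightarrow> real^2 \<Rightarrow> real \<Rightarrow> real^2" where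
  "headway_tangent \<kappa>e xs x \<theta> =
     (let xe = headway_point \<kappa>e xs x \<theta>
      in if xe \<noteq> xs then (xs - xe) /\<^sub>R norm (xs - xe) else 0)"

definition headway_normal :: "real \<Rightarrow> real^2 \<Rightarrow> real^2 \<Rightarrow> real \<Rightarrow> real^2" where
  "headway_normal \<kappa>e xs x \<theta> =
     (if (xs - x) \<bullet> heading_normal \<theta> \<ge> 0
      then rotation2 (pi / 2) *v headway_tangent \<kappa>e xs x \<theta>
      else rotation2 (- (pi / 2)) *v headway_tangent \<kappa>e xs x \<theta>)"

definition projected_position :: "real \<Rightarrow> real^2 \<Rightarrow> real^2 \<Rightarrow> real \<Rightarrow> real^2" where
  "projected_position \<kappa>e xs x \<theta> =
     (let te = headway_tangent \<kappa>e xs x \<theta> in xs + (te \<bullet> (x - xs)) *\<^sub>R te)"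

definition extended_position :: "real \<Rightarrow> real^2 \<Rightarrow> real^2 \<Rightarrow> real \<Rightarrow> real^2" where
  "extended_position \<kappa>e xs x \<theta> =
     (let xp = projected_position \<kappa>e xs x \<theta>
      in xp + (\<kappa>e / sqrt (1 - \<kappa>e\<^sup>2) * norm (xp - xs)) *\<^sub>R headway_normal \<kappa>e xs x \<theta>)"

end

theory Submission imports Defs begin

text \<open>Write \<open>d = xs - x\<close>, \<open>r = norm d\<close>, and let \<open>P\<close>, \<open>Q\<close> be the components of \<open>d\<close> along the heading and its
  normal. The vector \<open>e = d - k r o(\<theta>)\<close> from the headway point to the goal obeys \<open>e' = - \<kappa>r e\<close>, so the
  headway point runs straight into the goal and the headway tangent is constant. Since \<open>d\<close> and \<open>e\<close>
  satisfy \<open>norm (d - e) = k * norm d\<close>, the position always stays in the cone of half-angle \<open>arcsin k\<close> about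
  the tangent. Moreover \<open>Q\<close> keeps its sign, \<open>P / r\<close> increases, and the component of \<open>d\<close> along \<open>e\<close>
  decreases, which gives the larger triangle. If \<open>P / r \<ge> k\<close> initially, this persists, the speed is
  nonnegative, the angle between \<open>d\<close> and \<open>e\<close> decreases, and the heading only turns towards the tangent,
  so the position never crosses the line through the initial position and headway point.\<close>

section \<open>Planar vectors, the heading frame and the headway error\<close>

definition cross2 :: "real^2 \<Rightarrow> real^2 \<Rightarrow> real" where
  "cross2 a b = a $ 1 * b $ 2 - a $ 2 * b $ 1"

text \<open>The vector from the headway point to the goal, as a function of the displacement
  \<open>d\<close> from position to goal, so that lemmas about a single state need not mention
  \<open>xs\<close>.\<close>

definition headway_error :: "real \<Rightarrow> real^2 \<Rightarrow> real \<Rightarrow> real^2" where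
  "headway_error k d \<theta> = d - (k * norm d) *\<^sub>R heading \<theta>"

lemma inner_vec2: "(a::real^2) \<bullet> b = a $ 1 * b $ 1 + a $ 2 * b $ 2"
  by (simp add: inner_vec_def sum_2)

lemma vec2_eq_iff: "(a::real^2) = b \<longleftrightarrow> a $ 1 = b $ 1 \<and> a $ 2 = b $ 2"
  by (simp add: vec_eq_iff forall_2)

lemma heading_component [simp]:
  "heading \<theta> $ 1 = cos \<theta>" "heading \<theta> $ 2 = sin \<theta>"
  "heading_normal \<theta> $ 1 = - sin \<theta>" "heading_normal \<theta> $ 2 = cos \<theta>"
  by (simp_all add: heading_def heading_normal_def)

lemma norm_heading [simp]: "norm (heading \<theta>) = 1"
  by (simp add: norm_eq_1 inner_vec2 flip: power2_eq_square)

lemma heading_inner [simp]: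
  "heading \<theta> \<bullet> heading \<theta> = 1" "heading_normal \<theta> \<bullet> heading_normal \<theta> = 1"
  "heading \<theta> \<bullet> heading_normal \<theta> = 0" "heading_normal \<theta> \<bullet> heading \<theta> = 0"
  by (simp_all add: inner_vec2 flip: power2_eq_square)

lemma heading_decomp:
  "d = (heading \<theta> \<bullet> d) *\<^sub>R heading \<theta> + (heading_normal \<theta> \<bullet> d) *\<^sub>R heading_normal \<theta>"
proof -
  have "d $ 1 = d $ 1 * ((cos \<theta>)\<^sup>2 + (sin \<theta>)\<^sup>2)" "d $ 2 = d $ 2 * ((cos \<theta>)\<^sup>2 + (sin \<theta>)\<^sup>2)"
    by simp_all
  moreover have "(heading \<theta> \<bullet> d) * cos \<theta> - (heading_normal \<theta> \<bullet> d) * sin \<theta>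
      = d $ 1 * ((cos \<theta>)\<^sup>2 + (sin \<theta>)\<^sup>2)"
    "(heading \<theta> \<bullet> d) * sin \<theta> + (heading_normal \<theta> \<bullet> d) * cos \<theta>
      = d $ 2 * ((cos \<theta>)\<^sup>2 + (sin \<theta>)\<^sup>2)"
    unfolding inner_vec2 heading_component by algebra+
  ultimately show ?thesis
    by (simp add: vec2_eq_iff)
qed

lemma norm_heading_decomp: "(heading \<theta> \<bullet> d)\<^sup>2 + (heading_normal \<theta> \<bullet> d)\<^sup>2 = (norm d)\<^sup>2"
proof -
  have "d \<bullet> d = (heading \<theta> \<bullet> d) * (heading \<theta> \<bullet> d) + (heading_normal \<theta> \<bullet> d) * (heading_normal \<theta> \<bullet> d)"
    by (subst (1) heading_decomp[of d \<theta>]) (simp add: inner_add_left)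
  then show ?thesis
    by (simp only: power2_norm_eq_inner power2_eq_square[of "_ \<bullet> _"])
qed

lemma abs_heading_inner_le: "\<bar>heading \<theta> \<bullet> d\<bar> \<le> norm d"
  using Cauchy_Schwarz_ineq2[of "heading \<theta>" d] by simp

lemma headway_error_inner:
  "headway_error k d \<theta> \<bullet> d = norm d * (norm d - k * (heading \<theta> \<bullet> d))"
  "heading \<theta> \<bullet> headway_error k d \<theta> = heading \<theta> \<bullet> d - k * norm d"
  "heading_normal \<theta> \<bullet> headway_error k d \<theta> = heading_normal \<theta> \<bullet> d"
  by (simp_all add: headway_error_def inner_diff_left inner_diff_right right_diff_distrib
      flip: power2_norm_eq_inner) (simp add: power2_eq_square)

lemma headway_error_cross:
  "cross2 d (headway_error k d \<theta>) = k * norm d * (heading_normal \<theta> \<bullet> d)"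
  "cross2 (heading \<theta>) (headway_error k d \<theta>) = heading_normal \<theta> \<bullet> d"
  by (simp_all add: headway_error_def cross2_def inner_vec2 algebra_simps)

lemma norm_headway_error_ge:
  assumes "0 < k"
  shows "(1 - k) * norm d \<le> norm (headway_error k d \<theta>)"
  using norm_triangle_ineq2[of d "(k * norm d) *\<^sub>R heading \<theta>"] assms
  by (simp add: headway_error_def abs_mult algebra_simps)

text \<open>The headway is shorter than the distance to the goal because \<open>k < 1\<close>. Hence
  the headway tangent takes its default value 0 only at the goal.\<close>

lemma headway_error_eq_0_iff:
  assumes "0 < k" "k < 1"
  shows "headway_error k d \<theta> = 0 \<longleftrightarrow> d = 0"
  using norm_headway_error_ge[OF assms(1), of d \<theta>] assms
  by (auto simp: headway_error_def mult_le_0_iff)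

lemma diff_headway_point: "xs - headway_point k xs x \<theta> = headway_error k (xs - x) \<theta>"
  by (simp add: headway_point_def headway_error_def norm_minus_commute)

text \<open>By Cauchy-Schwarz. This quantity is \<open>norm d\<close> times the denominator of the
  linear velocity; multiplied by \<open>norm d\<close> again it is the inner product of
  \<open>d\<close> and the headway error.\<close>

lemma gap_pos:
  assumes "0 < k" "k < 1" "d \<noteq> 0"
  shows "0 < norm d - k * (heading \<theta> \<bullet> d)"
proof -
  have "k * (heading \<theta> \<bullet> d) \<le> k * norm d"
    using abs_heading_inner_le[of \<theta> d] assms by (intro mult_left_mono) auto
  moreover have "k * norm d < norm d"
    using assms by simp
  ultimately show ?thesis by simp
qed

text \<open>The subtraction formula for the sine, cleared of norms: the angle from \<open>a\<close>
  to \<open>b\<close> is measured through a reference vector \<open>c\<close>.\<close>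

lemma cross2_lagrange:
  "cross2 a b * (norm c)\<^sup>2 = cross2 a c * (c \<bullet> b) - (a \<bullet> c) * cross2 b c"
  by (simp add: power2_norm_eq_inner cross2_def inner_vec2 algebra_simps)

text \<open>Cramer's rule writes \<open>u\<close> as a combination of \<open>a\<close> and
  \<open>b\<close> whose coefficients are ratios of cross products; the hypotheses say that these
  are nonnegative with sum at most 1. The factor \<open>\<sigma>\<close> covers both
  orientations.\<close>

lemma mem_triangle_cross2:
  assumes "\<sigma> * cross2 a b > 0" "\<sigma> * cross2 u b \<ge> 0" "\<sigma> * cross2 a u \<ge> 0"
    and "\<sigma> * (cross2 u b + cross2 a u) \<le> \<sigma> * cross2 a b"
  shows "p - u \<in> convex hull {p, p - a, p - b}"
proof -
  define D where "D = \<sigma> * cross2 a b"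
  define \<alpha> where "\<alpha> = \<sigma> * cross2 u b / D"
  define \<beta> where "\<beta> = \<sigma> * cross2 a u / D"
  have D: "D > 0" using assms by (simp add: D_def)
  then have ne: "\<sigma> \<noteq> 0" "cross2 a b \<noteq> 0" by (auto simp: D_def)
  have ab: "\<alpha> \<ge> 0" "\<beta> \<ge> 0" "\<alpha> + \<beta> \<le> 1"
    using D assms(2-4) unfolding \<alpha>_def \<beta>_def add_divide_distrib[symmetric] D_def[symmetric]
    by (simp_all add: distrib_left)
  have u: "u = \<alpha> *\<^sub>R a + \<beta> *\<^sub>R b"
  proof -
    have "cross2 a b *\<^sub>R u = cross2 u b *\<^sub>R a + cross2 a u *\<^sub>R b"
      by (simp add: vec2_eq_iff cross2_def algebra_simps)
    moreover have "cross2 u b = \<alpha> * cross2 a b" "cross2 a u = \<beta> * cross2 a b"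
      using ne by (simp_all add: \<alpha>_def \<beta>_def D_def)
    ultimately have "cross2 a b *\<^sub>R u = cross2 a b *\<^sub>R (\<alpha> *\<^sub>R a + \<beta> *\<^sub>R b)"
      by (simp add: scaleR_add_right mult.commute)
    then show ?thesis
      using ne by simp
  qed
  have "p - u = (1 - \<alpha> - \<beta>) *\<^sub>R p + \<alpha> *\<^sub>R (p - a) + \<beta> *\<^sub>R (p - b)"
    unfolding u by (simp add: algebra_simps)
  then show ?thesis
    unfolding convex_hull_3 using ab
    by (intro CollectI exI[of _ "1 - \<alpha> - \<beta>"] exI[of _ \<alpha>] exI[of _ \<beta>]) simp
qed

section \<open>Geometry of the two triangles at a single state\<close>

lemma rotation2_quarter:
  "rotation2 (pi / 2) *v a = vector [- a $ 2, a $ 1]"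
  "rotation2 (- (pi / 2)) *v a = - vector [- a $ 2, a $ 1]"
  by (simp_all add: rotation2_def vec2_eq_iff matrix_vector_mult_def sum_2)

text \<open>Coordinates of the larger triangle in the frame of the headway tangent \<open>t\<close>;
  \<open>\<sigma>\<close> records on which side of the line through \<open>t\<close> it lies.\<close>

lemma big_triangle_vertices:
  fixes xs x :: "real^2" and \<theta> :: real
  assumes k: "0 < k" "k < 1" and ne: "x \<noteq> xs"
  defines "d \<equiv> xs - x"
  defines "e \<equiv> headway_error k d \<theta>"
  defines "t \<equiv> e /\<^sub>R norm e"
  defines "\<sigma> \<equiv> (if heading_normal \<theta> \<bullet> d \<ge> 0 then 1 else - 1)"
  shows "projected_position k xs x \<theta> = xs - (d \<bullet> t) *\<^sub>R t"
    and "extended_position k xs x \<theta> = xs - ((d \<bullet> t) *\<^sub>R t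
      - (k / sqrt (1 - k\<^sup>2) * (d \<bullet> t) * \<sigma>) *\<^sub>R vector [- t $ 2, t $ 1])"
    and "d \<bullet> t > 0" and "norm t = 1"
proof -
  have d0: "d \<noteq> 0" using ne by (simp add: d_def)
  have e0: "e \<noteq> 0" using headway_error_eq_0_iff[OF k] d0 by (simp add: e_def)
  then show nt: "norm t = 1" by (simp add: t_def)
  have "e \<bullet> d > 0"
    using gap_pos[OF k d0] d0 by (simp add: e_def headway_error_inner)
  then show dt: "d \<bullet> t > 0"
    using e0 by (simp add: t_def inner_commute)
  have hp: "xs - headway_point k xs x \<theta> = e"
    by (simp add: diff_headway_point e_def d_def)
  have ht: "headway_tangent k xs x \<theta> = t"
    using e0 hp by (auto simp: headway_tangent_def Let_def t_def)
  have hn: "headway_normal k xs x \<theta> = \<sigma> *\<^sub>R vector [- t $ 2, t $ 1]"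
    by (simp add: headway_normal_def ht rotation2_quarter \<sigma>_def d_def inner_commute)
  have "x - xs = - d" by (simp add: d_def)
  then show pp: "projected_position k xs x \<theta> = xs - (d \<bullet> t) *\<^sub>R t"
    by (simp add: projected_position_def ht Let_def inner_commute)
  have "norm (projected_position k xs x \<theta> - xs) = d \<bullet> t"
    using dt nt by (simp add: pp)
  then show "extended_position k xs x \<theta> = xs - ((d \<bullet> t) *\<^sub>R t
      - (k / sqrt (1 - k\<^sup>2) * (d \<bullet> t) * \<sigma>) *\<^sub>R vector [- t $ 2, t $ 1])"
    by (simp add: extended_position_def hn Let_def) (simp add: pp)
qed

text \<open>The larger triangle is right-angled at the projected position, and its angle at the goal
  is arcsin \<open>k\<close>, with tangent \<open>k / sqrt (1 - k\<^sup>2)\<close>. Membership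
  therefore means lying on the correct side of \<open>e\<close>, not beyond the projected position
  along \<open>e\<close>, and inside this cone, whose condition is squared to avoid the
  root.\<close>

lemma mem_big_triangle:
  fixes xs x :: "real^2" and \<theta> :: real
  assumes k: "0 < k" "k < 1" and ne: "x \<noteq> xs"
  defines "d \<equiv> xs - x"
  defines "e \<equiv> headway_error k d \<theta>"
  defines "\<sigma> \<equiv> (if heading_normal \<theta> \<bullet> d \<ge> 0 then 1 else - 1)"
  assumes u: "0 \<le> u \<bullet> e" "u \<bullet> e \<le> d \<bullet> e" "0 \<le> \<sigma> * cross2 u e"
    and cone: "(cross2 u e)\<^sup>2 * (1 - k\<^sup>2) \<le> k\<^sup>2 * (u \<bullet> e)\<^sup>2"
  shows "xs - u \<in> convex hull {xs, projected_position k xs x \<theta>, extended_position k xs x \<theta>}"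
proof -
  define t where "t = e /\<^sub>R norm e"
  define \<kappa> where "\<kappa> = k / sqrt (1 - k\<^sup>2)"
  define A where "A = d \<bullet> t"
  note V = big_triangle_vertices[OF k ne, of \<theta>, folded d_def, folded e_def, folded t_def,
      folded \<sigma>_def, folded \<kappa>_def A_def]
  have k2: "k\<^sup>2 < 1" using k by (simp add: power_less_one_iff)
  have \<kappa>: "\<kappa> > 0" using k k2 by (simp add: \<kappa>_def)
  have \<sigma>2: "\<sigma> * \<sigma> = 1" by (simp add: \<sigma>_def)
  have e0: "norm e > 0" using V(4) by (auto simp: t_def)
  have ut: "u \<bullet> t = (u \<bullet> e) / norm e" and ct: "cross2 u t = cross2 u e / norm e"
    by (simp_all add: t_def divide_inverse cross2_def algebra_simps)
  have Adef: "A = (d \<bullet> e) / norm e" by (simp add: A_def t_def divide_inverse mult.commute)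
  have 1: "u \<bullet> t \<le> A" "0 \<le> \<sigma> * cross2 u t" "0 \<le> u \<bullet> t"
    using u e0 by (simp_all add: ut ct Adef divide_right_mono)
  have "(cross2 u e)\<^sup>2 \<le> k\<^sup>2 * (u \<bullet> e)\<^sup>2 / (1 - k\<^sup>2)"
    using cone k2 by (simp add: pos_le_divide_eq)
  also have "\<dots> = (\<kappa> * (u \<bullet> e))\<^sup>2"
    using k2 by (simp add: \<kappa>_def power_mult_distrib power_divide)
  finally have "(\<sigma> * cross2 u e)\<^sup>2 \<le> (\<kappa> * (u \<bullet> e))\<^sup>2"
    by (simp add: \<sigma>_def)
  moreover have "0 \<le> \<kappa> * (u \<bullet> e)"
    using u(1) \<kappa> by simp
  ultimately have "\<sigma> * cross2 u e \<le> \<kappa> * (u \<bullet> e)"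
    by (rule power2_le_imp_le)
  then have 2: "\<sigma> * cross2 u t \<le> \<kappa> * (u \<bullet> t)"
    using e0 by (simp add: ut ct divide_right_mono)
  define p where "p = A *\<^sub>R t"
  define q where "q = A *\<^sub>R t - (\<kappa> * A * \<sigma>) *\<^sub>R vector [- t $ 2, t $ 1]"
  have tt: "t $ 1 * t $ 1 + t $ 2 * t $ 2 = 1"
    using V(4) by (metis inner_vec2 norm_eq_1)
  have pq: "cross2 p q = - (\<kappa> * A\<^sup>2 * \<sigma>)"
  proof -
    have "cross2 p q = - (\<kappa> * A\<^sup>2 * \<sigma>) * (t $ 1 * t $ 1 + t $ 2 * t $ 2)"
      by (simp add: cross2_def p_def q_def algebra_simps power2_eq_square)
    then show ?thesis by (simp add: tt)
  qed
  have uq: "cross2 u q = A * cross2 u t - \<kappa> * A * \<sigma> * (u \<bullet> t)"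
    by (simp add: cross2_def q_def inner_vec2 algebra_simps)
  have pu: "cross2 p u = - (A * cross2 u t)"
    by (simp add: cross2_def p_def algebra_simps)
  have "xs - u \<in> convex hull {xs, xs - p, xs - q}"
  \<comment> \<open>\<open>cross2 p q\<close> has the sign of \<open>- \<sigma>\<close>, since
    subtracting the normal part from \<open>p\<close> turns it the other way.\<close>
  proof (rule mem_triangle_cross2[where \<sigma> = "- \<sigma>"])
    have "- \<sigma> * cross2 p q = \<kappa> * A\<^sup>2 * (\<sigma> * \<sigma>)"
      by (simp add: pq)
    then show "- \<sigma> * cross2 p q > 0" using \<sigma>2 \<kappa> V(3) by simp
    have "- \<sigma> * cross2 u q = A * (\<kappa> * (u \<bullet> t) * (\<sigma> * \<sigma>) - \<sigma> * cross2 u t)"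
      by (simp add: uq algebra_simps)
    then show "- \<sigma> * cross2 u q \<ge> 0" using \<sigma>2 2 V(3) by simp
    have "- \<sigma> * cross2 p u = A * (\<sigma> * cross2 u t)"
      by (simp add: pu)
    then show "- \<sigma> * cross2 p u \<ge> 0" using 1 V(3) by simp
    have "- \<sigma> * cross2 p q - - \<sigma> * (cross2 u q + cross2 p u) = \<kappa> * A * (A - u \<bullet> t) * (\<sigma> * \<sigma>)"
      by (simp add: pq uq pu algebra_simps power2_eq_square)
    moreover have "\<dots> \<ge> 0" using \<sigma>2 1 \<kappa> V(3) by simp
    ultimately show "- \<sigma> * (cross2 u q + cross2 p u) \<le> - \<sigma> * cross2 p q" by simp
  qed
  then show ?thesis
    using V(1,2) by (simp add: p_def q_def)
qed

text \<open>With \<open>P\<close>, \<open>Q\<close>, \<open>r\<close> as in the proof, the right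
  side exceeds the left by the square of \<open>k * r * (P - k * r)\<close>. Thus \<open>d\<close>
  lies on the edge of the cone exactly when this product vanishes, as it does at the critical angle
  \<open>P = k * r\<close>.\<close>

lemma headway_error_cone:
  assumes "k < 1" "0 < k"
  shows "(cross2 d (headway_error k d \<theta>))\<^sup>2 * (1 - k\<^sup>2) \<le> k\<^sup>2 * (d \<bullet> headway_error k d \<theta>)\<^sup>2"
proof -
  define P where "P = heading \<theta> \<bullet> d"
  define Q where "Q = heading_normal \<theta> \<bullet> d"
  define r where "r = norm d"
  have Q2: "Q\<^sup>2 = r\<^sup>2 - P\<^sup>2"
    using norm_heading_decomp[of \<theta> d] by (simp add: P_def Q_def r_def)
  have "(k * r * Q)\<^sup>2 * (1 - k\<^sup>2) = k\<^sup>2 * r\<^sup>2 * ((r\<^sup>2 - P\<^sup>2) * (1 - k\<^sup>2))"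
    by (simp add: power_mult_distrib Q2)
  also have "\<dots> \<le> k\<^sup>2 * r\<^sup>2 * (r - k * P)\<^sup>2"
  proof (rule mult_left_mono)
    have "(r - k * P)\<^sup>2 - (r\<^sup>2 - P\<^sup>2) * (1 - k\<^sup>2) = (P - k * r)\<^sup>2"
      by (simp add: power2_eq_square algebra_simps)
    then show "(r\<^sup>2 - P\<^sup>2) * (1 - k\<^sup>2) \<le> (r - k * P)\<^sup>2"
      by (metis diff_ge_0_iff_ge zero_le_power2)
  qed simp
  finally show ?thesis
    by (simp add: headway_error_cross inner_commute[of d] headway_error_inner P_def Q_def r_def
        power_mult_distrib mult.assoc)
qed

lemma heading_goal_dir: "heading \<theta> \<bullet> goal_dir xs x = (heading \<theta> \<bullet> (xs - x)) / norm (xs - x)"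
  by (simp add: goal_dir_def divide_inverse mult.commute)

lemma heading_normal_goal_dir:
  "heading_normal \<theta> \<bullet> goal_dir xs x = (heading_normal \<theta> \<bullet> (xs - x)) / norm (xs - x)"
  by (simp add: goal_dir_def divide_inverse mult.commute)

text \<open>By convexity it is enough to place the three vertices: the position lies in the cone
  about the tangent, and the headway point lies on its axis.\<close>

lemma small_triangle_subset_big_triangle:
  assumes k: "0 < k" "k < 1" and c: "k \<le> heading \<theta> \<bullet> goal_dir xs x"
  shows "convex hull {xs, x, headway_point k xs x \<theta>} \<subseteq>
         convex hull {xs, projected_position k xs x \<theta>, extended_position k xs x \<theta>}"
    (is "_ \<subseteq> ?T")
proof -
  \<comment> \<open>At the goal the default \<open>goal_dir xs x = 0\<close> would turn the
    hypothesis into \<open>k \<le> 0\<close>.\<close>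
  have ne: "x \<noteq> xs" using k c by (auto simp: goal_dir_def)
  define d where "d = xs - x"
  define e where "e = headway_error k d \<theta>"
  have r: "norm d > 0" using ne by (simp add: d_def)
  have P: "k * norm d \<le> heading \<theta> \<bullet> d"
    using c r by (simp add: heading_goal_dir d_def field_simps)
  have de: "d \<bullet> e \<ge> 0"
    using gap_pos[OF k, of d \<theta>] r by (simp add: e_def inner_commute[of d] headway_error_inner)
  have "xs - d \<in> ?T"
  proof (rule mem_big_triangle[OF k ne, of _ \<theta>, folded d_def, folded e_def])
    show "0 \<le> (if heading_normal \<theta> \<bullet> d \<ge> 0 then 1 else - 1) * cross2 d e"
      using k r by (auto simp: e_def headway_error_cross mult_nonneg_nonpos)
    show "(cross2 d e)\<^sup>2 * (1 - k\<^sup>2) \<le> k\<^sup>2 * (d \<bullet> e)\<^sup>2"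
      unfolding e_def by (rule headway_error_cone[OF k(2,1)])
  qed (use de in auto)
  moreover have "xs - e \<in> ?T"
  proof (rule mem_big_triangle[OF k ne, of _ \<theta>, folded d_def, folded e_def])
    \<comment> \<open>The angle hypothesis gives the heading a nonnegative component along
      \<open>e\<close>, so the headway point is no farther from the goal than the projected
      position.\<close>
    have "d \<bullet> e - e \<bullet> e = k * norm d * (heading \<theta> \<bullet> e)"
      by (simp add: e_def headway_error_def inner_diff_left)
    moreover have "\<dots> \<ge> 0"
      using P k r by (simp add: e_def headway_error_inner)
    ultimately show "e \<bullet> e \<le> d \<bullet> e" by simp
  qed (auto simp: cross2_def)
  moreover have "xs \<in> ?T" by (simp add: hull_inc)
  moreover have "xs - e = headway_point k xs x \<theta>" "xs - d = x"
    by (simp_all add: e_def d_def flip: diff_headway_point)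
  ultimately have "{xs, x, headway_point k xs x \<theta>} \<subseteq> ?T"
    by (simp only: insert_subset empty_subsetI simp_thms)
  then show ?thesis
    by (intro hull_minimal convex_convex_hull)
qed

text \<open>Here \<open>e\<close> has no component along the heading, so the triangle of goal,
  position and headway point is right-angled at the headway point. Projecting \<open>d\<close> onto
  \<open>e\<close> gives \<open>e\<close> itself, and the legs
  \<open>sqrt (1 - k\<^sup>2) * norm d\<close> and \<open>k * norm d\<close> match the lengths in
  the extended position.\<close>

lemma positions_at_critical_angle:
  assumes k: "0 < k" "k < 1" and c: "heading \<theta> \<bullet> goal_dir xs x = k"
  shows "extended_position k xs x \<theta> = x" and "projected_position k xs x \<theta> = headway_point k xs x \<theta>"
proof -
  have ne: "x \<noteq> xs" using k c by (auto simp: goal_dir_def)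
  define d where "d = xs - x"
  define e where "e = headway_error k d \<theta>"
  define t where "t = e /\<^sub>R norm e"
  define \<sigma> :: real where "\<sigma> = (if heading_normal \<theta> \<bullet> d \<ge> 0 then 1 else - 1)"
  note V = big_triangle_vertices[OF k ne, of \<theta>, folded d_def, folded e_def, folded t_def,
      folded \<sigma>_def]
  have r: "norm d > 0" using ne by (simp add: d_def)
  have P: "heading \<theta> \<bullet> d = k * norm d"
    using c r by (simp add: heading_goal_dir d_def field_simps)
  have e0: "norm e > 0" using V(4) by (auto simp: t_def)
  have e: "e = (heading_normal \<theta> \<bullet> d) *\<^sub>R heading_normal \<theta>"
    using heading_decomp[of e \<theta>] P by (simp add: e_def headway_error_inner)
  have nn: "norm (heading_normal \<theta>) = 1" by (simp add: norm_eq_1)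
  have "norm e = \<bar>heading_normal \<theta> \<bullet> d\<bar>"
    by (subst e) (simp add: nn)
  then have Q: "heading_normal \<theta> \<bullet> d = \<sigma> * norm e" by (simp add: \<sigma>_def)
  have \<sigma>2: "\<sigma> * \<sigma> = 1" by (simp add: \<sigma>_def)
  have t: "t = \<sigma> *\<^sub>R heading_normal \<theta>"
    using e0 by (simp add: t_def) (subst e, simp add: Q)
  have dt: "d \<bullet> t = norm e"
    using \<sigma>2 Q by (simp add: t inner_commute[of d] mult.assoc[symmetric])
  have et: "(d \<bullet> t) *\<^sub>R t = e" using dt e0 by (simp add: t_def)
  show "projected_position k xs x \<theta> = headway_point k xs x \<theta>"
    using V(1) diff_headway_point[of xs k x \<theta>, folded d_def, folded e_def]
    by (simp only: et) (metis diff_diff_eq2 add_diff_cancel_left')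
  have "(norm e)\<^sup>2 = (1 - k\<^sup>2) * (norm d)\<^sup>2"
    using norm_heading_decomp[of \<theta> d] \<sigma>2 P Q
    by (simp add: power_mult_distrib algebra_simps power2_eq_square[of \<sigma>])
  then have "norm e = sqrt (1 - k\<^sup>2) * norm d"
    by (metis norm_ge_zero real_sqrt_abs real_sqrt_mult abs_of_nonneg)
  moreover have "k\<^sup>2 < 1" using k by (simp add: power_less_one_iff)
  ultimately have "k / sqrt (1 - k\<^sup>2) * (d \<bullet> t) = k * norm d"
    by (simp add: dt)
  moreover have "\<sigma> *\<^sub>R vector [- t $ 2, t $ 1] = - heading \<theta>"
    using \<sigma>2 by (simp add: vec2_eq_iff t mult.assoc[symmetric])
  ultimately have "extended_position k xs x \<theta> = xs - (e + (k * norm d) *\<^sub>R heading \<theta>)"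
    using V(2) by (simp add: et flip: scaleR_scaleR)
  then show "extended_position k xs x \<theta> = x"
    by (simp add: e_def headway_error_def d_def)
qed


section \<open>Calculus with one-sided derivatives, and scalar comparison tools\<close>

lemma has_vector_derivative_inner:
  assumes "(f has_vector_derivative f') (at t within S)" "(g has_vector_derivative g') (at t within S)"
  shows "((\<lambda>t. f t \<bullet> g t) has_real_derivative f t \<bullet> g' + f' \<bullet> g t) (at t within S)"
  unfolding has_real_derivative_iff_has_vector_derivative
  by (rule bounded_bilinear.has_vector_derivative[OF bounded_bilinear_inner assms])

lemma has_real_derivative_norm:
  fixes f :: "real \<Rightarrow> 'a::real_inner"
  assumes "(f has_vector_derivative f') (at t within S)" "f t \<noteq> 0"
  shows "((\<lambda>t. norm (f t)) has_real_derivative (f t \<bullet> f') / norm (f t)) (at t within S)"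
proof -
  have "((\<lambda>t. f t \<bullet> f t) has_real_derivative f t \<bullet> f' + f' \<bullet> f t) (at t within S)"
    by (rule has_vector_derivative_inner[OF assms(1) assms(1)])
  then have "((\<lambda>t. sqrt (f t \<bullet> f t)) has_real_derivative
      (inverse (sqrt (f t \<bullet> f t)) / 2) * (f t \<bullet> f' + f' \<bullet> f t)) (at t within S)"
    using assms(2) by (intro DERIV_chain2[where f = sqrt] DERIV_real_sqrt) auto
  moreover have "(inverse (sqrt (f t \<bullet> f t)) / 2) * (f t \<bullet> f' + f' \<bullet> f t) = (f t \<bullet> f') / norm (f t)"
    by (simp add: norm_eq_sqrt_inner inner_commute[of f'] field_simps)
  ultimately show ?thesis
    by (simp only: norm_eq_sqrt_inner)
qed

text \<open>The norm itself is not differentiable at 0, but a function that vanishes to first order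
  has a norm that does so as well.\<close>

lemma has_real_derivative_norm_at_zero:
  fixes f :: "real \<Rightarrow> 'a::real_normed_vector"
  assumes "(f has_vector_derivative 0) (at t within S)" "f t = 0"
  shows "((\<lambda>t. norm (f t)) has_real_derivative 0) (at t within S)"
proof -
  have "((\<lambda>y. (1 / norm (y - t)) *\<^sub>R f y) \<longlongrightarrow> 0) (at t within S)"
    using assms by (simp add: has_vector_derivative_def has_derivative_within)
  then have "((\<lambda>y. norm ((1 / norm (y - t)) *\<^sub>R f y)) \<longlongrightarrow> 0) (at t within S)"
    by (rule tendsto_norm_zero)
  then show ?thesis
    using assms(2) by (simp add: has_real_derivative_iff_has_vector_derivative
        has_vector_derivative_def has_derivative_within)
qed

lemma has_vector_derivative_heading:
  assumes "(\<theta> has_real_derivative w) (at t within S)"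
  shows "((\<lambda>t. heading (\<theta> t)) has_vector_derivative w *\<^sub>R heading_normal (\<theta> t)) (at t within S)"
    and "((\<lambda>t. heading_normal (\<theta> t)) has_vector_derivative - w *\<^sub>R heading (\<theta> t)) (at t within S)"
proof -
  \<comment> \<open>Expanding in the constant frame \<open>heading 0\<close>,
    \<open>heading_normal 0\<close> reduces the claim to the derivatives of sine and cosine.\<close>
  have h: "heading a = cos a *\<^sub>R heading 0 + sin a *\<^sub>R heading_normal 0"
    and n: "heading_normal a = - sin a *\<^sub>R heading 0 + cos a *\<^sub>R heading_normal 0" for a
    by (simp_all add: vec2_eq_iff)
  show "((\<lambda>t. heading (\<theta> t)) has_vector_derivative w *\<^sub>R heading_normal (\<theta> t)) (at t within S)"
    unfolding h[of "\<theta> _"] n[of "\<theta> _"]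
    by (rule has_vector_derivative_eq_rhs, (rule derivative_intros assms)+)
       (simp add: vec2_eq_iff algebra_simps)
  show "((\<lambda>t. heading_normal (\<theta> t)) has_vector_derivative - w *\<^sub>R heading (\<theta> t)) (at t within S)"
    unfolding h[of "\<theta> _"] n[of "\<theta> _"]
    by (rule has_vector_derivative_eq_rhs, (rule derivative_intros assms)+)
       (simp add: vec2_eq_iff algebra_simps)
qed

lemma exponential_decay:
  fixes f :: "real \<Rightarrow> 'a::real_normed_vector"
  assumes "\<And>t. t \<ge> 0 \<Longrightarrow> (f has_vector_derivative - a *\<^sub>R f t) (at t within {0..})" and "t \<ge> 0"
  shows "f t = exp (- a * t) *\<^sub>R f 0"
proof -
  have "((\<lambda>t. exp (a * t) *\<^sub>R f t) has_vector_derivative 0) (at t within {0..})" if "t \<in> {0..}" for t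
  proof -
    have "((\<lambda>t. exp (a * t)) has_real_derivative exp (a * t) * a) (at t within {0..})"
      by (auto intro!: derivative_eq_intros)
    from has_vector_derivative_scaleR[OF this assms(1)[of t]] that show ?thesis
      by simp
  qed
  then obtain c where "\<And>t. t \<in> {0..} \<Longrightarrow> exp (a * t) *\<^sub>R f t = c"
    using has_vector_derivative_zero_constant[of "{0..}" "\<lambda>t. exp (a * t) *\<^sub>R f t"] by auto
  from this[of 0] this[of t] assms(2) have "exp (a * t) *\<^sub>R f t = f 0" by simp
  then have "exp (- a * t) *\<^sub>R exp (a * t) *\<^sub>R f t = exp (- a * t) *\<^sub>R f 0" by simp
  then show ?thesis by (simp flip: exp_add)
qed

text \<open>The integrating factor is \<open>exp (- G t)\<close> with \<open>G\<close> an
  antiderivative of \<open>g\<close>. Positivity of \<open>c\<close> is what matters: a solution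
  keeps its initial sign, or stays 0.\<close>

lemma linear_ode_proportional:
  fixes f g :: "real \<Rightarrow> real"
  assumes "\<And>t. t \<ge> 0 \<Longrightarrow> (f has_real_derivative g t * f t) (at t within {0..})"
    and "continuous_on {0..} g" and "T \<ge> 0"
  shows "\<exists>c>0. f T = c * f 0"
proof -
  define G where "G t = integral {0..t} g" for t
  have "continuous_on {0..T} g"
    using assms(2) by (rule continuous_on_subset) auto
  then have G: "(G has_real_derivative g t) (at t within {0..T})" if "t \<in> {0..T}" for t
    unfolding G_def using that by (rule integral_has_real_derivative)
  have "((\<lambda>t. exp (- G t) * f t) has_real_derivative 0) (at t within {0..T})" if "t \<in> {0..T}" for t
  proof -
    have "(f has_real_derivative g t * f t) (at t within {0..T})"
      using assms(1)[of t] that by (auto intro: DERIV_subset)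
    with G[OF that] show ?thesis
      by (auto intro!: derivative_eq_intros simp: algebra_simps)
  qed
  then obtain c where c: "\<And>t. t \<in> {0..T} \<Longrightarrow> exp (- G t) * f t = c"
    using has_field_derivative_zero_constant[of "{0..T}" "\<lambda>t. exp (- G t) * f t"] by auto
  have "exp (- G T) * f T = exp (- G 0) * f 0"
    using c[of 0] c[of T] assms(3) by simp
  then have "exp (G T) * exp (- G T) * f T = exp (G T) * exp (- G 0) * f 0" by simp
  then have "f T = exp (G T) * exp (- G 0) * f 0" by (simp add: exp_minus)
  then show ?thesis
    by (intro exI[of _ "exp (G T) * exp (- G 0)"]) simp
qed

lemma nondecreasing_from_start:
  fixes f :: "real \<Rightarrow> real"
  assumes "\<And>t. t \<ge> 0 \<Longrightarrow> (f has_real_derivative f' t) (at t within {0..})"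
    and "\<And>t. t \<ge> 0 \<Longrightarrow> f' t \<ge> 0" and "T \<ge> 0"
  shows "f 0 \<le> f T"
proof (cases "T = 0")
  case False
  then have "T > 0" using assms(3) by simp
  have "(f has_derivative (\<lambda>h. f' t * h)) (at t within {0..T})" if "0 \<le> t" "t \<le> T" for t
    using assms(1)[of t] that by (auto simp: has_field_derivative_def intro: has_derivative_subset)
  from mvt_simple[OF \<open>T > 0\<close> this] obtain t where "t \<in> {0<..<T}" "f T - f 0 = f' t * (T - 0)"
    by auto
  moreover have "f' t * (T - 0) \<ge> 0" using assms(2)[of t] \<open>T > 0\<close> \<open>t \<in> _\<close> by auto
  ultimately show ?thesis by simp
qed simp

text \<open>The function \<open>c \<mapsto> sqrt (1 - c\<^sup>2) / (1 - k c)\<close> decreases on \<open>[k, 1]\<close>.\<close>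

lemma sine_ratio_le:
  fixes k c0 c s0 s :: real
  assumes k: "0 < k" "k < 1" and c: "k \<le> c0" "c0 \<le> c" "c \<le> 1"
    and s: "s\<^sup>2 = 1 - c\<^sup>2" "s0\<^sup>2 = 1 - c0\<^sup>2" "0 \<le> s" "0 \<le> s0"
  shows "s * (1 - k * c0) \<le> s0 * (1 - k * c)" and "s \<le> s0"
proof -
  have g: "1 - k * a \<ge> 0" if "a \<le> 1" for a
    using mult_left_mono[OF that, of k] k by linarith
  \<comment> \<open>After replacing the squared sines by cosines the difference factors, and
    \<open>k \<le> c0 \<le> c \<le> 1\<close> makes every factor nonnegative.\<close>
  have "(s0 * (1 - k * c))\<^sup>2 - (s * (1 - k * c0))\<^sup>2
      = (c - c0) * ((1 - k * c0) * (c - k) + (1 - k * c) * (c0 - k))"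
    unfolding power_mult_distrib s by algebra
  also have "\<dots> \<ge> 0"
    using c g[of c] g[of c0] by (intro mult_nonneg_nonneg add_nonneg_nonneg) auto
  finally show "s * (1 - k * c0) \<le> s0 * (1 - k * c)"
    using s g[of c] c by (auto intro!: power2_le_imp_le[of "s * (1 - k * c0)"])
  have "c0\<^sup>2 \<le> c\<^sup>2" using c k by (intro power_mono) auto
  then show "s \<le> s0" using s by (auto intro!: power2_le_imp_le[of s])
qed

section \<open>The closed loop in the moving heading frame\<close>

locale closed_loop =
  fixes \<kappa>r k :: real and xs :: "real^2" and x :: "real \<Rightarrow> real^2" and \<theta> :: "real \<Rightarrow> real"
  assumes kr: "\<kappa>r > 0" and k: "0 < k" "k < 1" and traj: "closed_loop_trajectory \<kappa>r k xs x \<theta>"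
begin

definition d where "d t = xs - x t"
definition r where "r t = norm (d t)"
definition P where "P t = heading (\<theta> t) \<bullet> d t"
definition Q where "Q t = heading_normal (\<theta> t) \<bullet> d t"
definition e where "e t = headway_error k (d t) (\<theta> t)"
definition V where "V t = linear_velocity \<kappa>r k xs (x t) (\<theta> t)"
definition W where "W t = angular_velocity \<kappa>r k xs (x t) (\<theta> t)"

lemma d_eq_0_iff: "d t = 0 \<longleftrightarrow> x t = xs"
  by (auto simp: d_def)

lemma PQ: "(P t)\<^sup>2 + (Q t)\<^sup>2 = (r t)\<^sup>2"
  unfolding P_def Q_def r_def by (rule norm_heading_decomp)

lemma gap: "d t \<noteq> 0 \<Longrightarrow> r t - k * P t > 0"
  using gap_pos[OF k, of "d t" "\<theta> t"] by (simp add: r_def P_def)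

text \<open>Scaling by \<open>r t\<close> removes \<open>goal_dir\<close>; as the denominator is
  then positive by \<open>gap\<close>, the speed has the sign of
  \<open>P t - k * r t\<close>.\<close>

lemma V_eq: assumes "d t \<noteq> 0" shows "V t = \<kappa>r * r t * (P t - k * r t) / (r t - k * P t)"
proof -
  have r: "r t > 0" using assms by (simp add: r_def)
  have "V t = \<kappa>r * r t * (P t / r t - k) / (1 - k * (P t / r t))"
    using assms by (simp add: V_def linear_velocity_def d_eq_0_iff heading_goal_dir)
      (simp add: d_def r_def P_def)
  moreover have "P t / r t - k = (P t - k * r t) / r t" "1 - k * (P t / r t) = (r t - k * P t) / r t"
    using r by (simp_all add: field_simps)
  ultimately show ?thesis
    using r by simp
qed

lemma W_eq: "d t \<noteq> 0 \<Longrightarrow> W t = \<kappa>r / k * (Q t / r t)"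
  by (simp add: W_def angular_velocity_def d_eq_0_iff heading_normal_goal_dir)
    (simp add: d_def r_def Q_def)

lemma VW_0: "d t = 0 \<Longrightarrow> V t = 0" "d t = 0 \<Longrightarrow> W t = 0"
  by (simp_all add: V_def W_def d_eq_0_iff linear_velocity_def angular_velocity_def)

lemma deriv_d: "t \<ge> 0 \<Longrightarrow> (d has_vector_derivative - V t *\<^sub>R heading (\<theta> t)) (at t within {0..})"
  using traj unfolding d_def V_def closed_loop_trajectory_def
  by (auto intro!: derivative_eq_intros)

lemma deriv_theta: "t \<ge> 0 \<Longrightarrow> (\<theta> has_real_derivative W t) (at t within {0..})"
  using traj unfolding W_def closed_loop_trajectory_def by auto

lemmas deriv_heading = has_vector_derivative_heading[OF deriv_theta]

lemma deriv_r:
  assumes "t \<ge> 0" "d t \<noteq> 0"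
  shows "(r has_real_derivative - V t * P t / r t) (at t within {0..})"
  using has_real_derivative_norm[OF deriv_d[OF assms(1)] assms(2)]
  by (simp add: r_def[abs_def] P_def inner_commute)

lemma deriv_P: "t \<ge> 0 \<Longrightarrow> (P has_real_derivative - V t + W t * Q t) (at t within {0..})"
  using has_vector_derivative_inner[OF deriv_heading(1) deriv_d, of t]
  by (simp add: P_def[abs_def] Q_def[abs_def])

text \<open>Translation is orthogonal to the heading normal, so only the rotation changes
  \<open>Q\<close>.\<close>

lemma deriv_Q: "t \<ge> 0 \<Longrightarrow> (Q has_real_derivative - W t * P t) (at t within {0..})"
  using has_vector_derivative_inner[OF deriv_heading(2) deriv_d, of t]
  by (simp add: P_def[abs_def] Q_def[abs_def])

text \<open>The headway point moves straight towards the goal at an exponential rate. This also holds at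
  the goal, where the norm is differentiable along the trajectory because the velocity vanishes;
  hence a trajectory can neither reach nor leave the goal in finite time.\<close>

lemma deriv_e:
  assumes t: "t \<ge> 0"
  shows "(e has_vector_derivative - \<kappa>r *\<^sub>R e t) (at t within {0..})"
proof -
  have e: "e = (\<lambda>t. d t - (k * r t) *\<^sub>R heading (\<theta> t))"
    by (simp add: fun_eq_iff e_def headway_error_def r_def)
  \<comment> \<open>The derivative of \<open>r\<close> is left as a parameter, so that one formula
    serves both at the goal, where it is 0, and away from it.\<close>
  have *: "(e has_vector_derivative - V t *\<^sub>R heading (\<theta> t)
      - ((k * r t) *\<^sub>R W t *\<^sub>R heading_normal (\<theta> t) + (k * r') *\<^sub>R heading (\<theta> t))) (at t within {0..})"
    if "(r has_real_derivative r') (at t within {0..})" for r'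
    unfolding e
    by (intro has_vector_derivative_diff has_vector_derivative_scaleR deriv_d deriv_heading t
        DERIV_cmult that)
  show ?thesis
  proof (cases "d t = 0")
    case True
    have "(r has_real_derivative 0) (at t within {0..})"
      using has_real_derivative_norm_at_zero[of d t] deriv_d[OF t] True
      by (simp add: VW_0 r_def[abs_def])
    from *[OF this] show ?thesis
      using True by (simp add: VW_0 e_def headway_error_def)
  next
    case False
    have r: "r t > 0" using False by (simp add: r_def)
    have g: "r t - k * P t > 0" using gap[OF False] .
    \<comment> \<open>Along the heading, the change of the headway length cancels the denominator of
      the speed; along the normal, the factor \<open>k\<close> cancels the one in the angular
      gain.\<close>
    have "V t - k * (V t * P t / r t) = V t * (r t - k * P t) / r t"
      using r by (simp add: field_simps)
    also have "\<dots> = \<kappa>r * (P t - k * r t)"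
      using r g by (simp add: V_eq[OF False])
    finally have 1: "V t - k * (V t * P t / r t) = \<kappa>r * (P t - k * r t)" .
    have 2: "k * r t * W t = \<kappa>r * Q t"
      using r k by (simp add: W_eq[OF False])
    have et: "e t = (P t - k * r t) *\<^sub>R heading (\<theta> t) + Q t *\<^sub>R heading_normal (\<theta> t)"
      using heading_decomp[of "e t" "\<theta> t"]
      unfolding e_def headway_error_inner P_def Q_def r_def .
    have "- \<kappa>r *\<^sub>R e t = - (V t - k * (V t * P t / r t)) *\<^sub>R heading (\<theta> t)
        - (k * r t * W t) *\<^sub>R heading_normal (\<theta> t)"
      unfolding 1 2 et by (simp add: algebra_simps)
    also have "\<dots> = - V t *\<^sub>R heading (\<theta> t) - ((k * r t) *\<^sub>R W t *\<^sub>R heading_normal (\<theta> t)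
        + (k * (- V t * P t / r t)) *\<^sub>R heading (\<theta> t))"
      by (simp add: scaleR_left_diff_distrib)
    finally have rhs: "- \<kappa>r *\<^sub>R e t = \<dots>" .
    show ?thesis
      unfolding rhs by (rule *[OF deriv_r[OF t False]])
  qed
qed

lemma e_eq: "t \<ge> 0 \<Longrightarrow> e t = exp (- \<kappa>r * t) *\<^sub>R e 0"
  by (rule exponential_decay[OF deriv_e])

text \<open>\<open>e\<close> vanishes exactly when \<open>d\<close> does, and the exponential factor
  is never 0.\<close>

lemma d_eq_0_iff_start: "t \<ge> 0 \<Longrightarrow> d t = 0 \<longleftrightarrow> d 0 = 0"
  using arg_cong[OF e_eq[of t], of "\<lambda>v. v = 0"] by (simp add: e_def headway_error_eq_0_iff[OF k])

end

section \<open>Trajectories starting away from the goal: confinement to the larger triangle\<close>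

locale closed_loop_off_goal = closed_loop +
  assumes off_goal: "x 0 \<noteq> xs"
begin

lemma d_nz: "t \<ge> 0 \<Longrightarrow> d t \<noteq> 0"
  using d_eq_0_iff_start[of t] off_goal by (simp add: d_eq_0_iff)

lemma r_pos: "t \<ge> 0 \<Longrightarrow> r t > 0"
  using d_nz by (simp add: r_def)

text \<open>Lets cross and inner products with the fixed vector \<open>e 0\<close> be read off, up
  to a positive factor, from the state at time \<open>t\<close>.\<close>

lemma e0_eq:
  assumes "t \<ge> 0"
  shows "e 0 = exp (\<kappa>r * t) *\<^sub>R e t"
proof -
  have "exp (\<kappa>r * t) *\<^sub>R e t = (exp (\<kappa>r * t) * exp (- \<kappa>r * t)) *\<^sub>R e 0"
    using e_eq[OF assms] by (simp only: scaleR_scaleR)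
  then show ?thesis by (simp add: exp_minus)
qed

text \<open>Inserting the angular velocity makes the equation for \<open>Q\<close> linear, with a
  coefficient that is continuous because \<open>r\<close> never vanishes. Hence the position keeps
  to one side of the tangent line.\<close>

lemma Q_proportional:
  assumes "t \<ge> 0"
  shows "\<exists>c>0. Q t = c * Q 0"
proof (rule linear_ode_proportional[OF _ _ assms])
  show "(Q has_real_derivative (- (\<kappa>r / k * (P t / r t))) * Q t) (at t within {0..})" if "t \<ge> 0" for t
    using deriv_Q[OF that] that by (simp add: W_eq d_nz field_simps)
  have "continuous_on {0..} P" "continuous_on {0..} r"
    by (auto intro!: DERIV_continuous_on deriv_P deriv_r d_nz)
  then show "continuous_on {0..} (\<lambda>t. - (\<kappa>r / k * (P t / r t)))"
    using d_nz by (intro continuous_intros) (auto simp: r_def)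
qed

text \<open>This is the cosine of the angle between heading and goal direction. The numerator of its
  derivative is \<open>\<kappa>r * (Q t)\<^sup>2\<close> times
  \<open>1 / k - (P t - k * r t) / (r t - k * P t)\<close>. The last factor is nonnegative because
  \<open>r - k * P - k * (P - k * r)\<close> equals
  \<open>r * (1 - k)\<^sup>2 + 2 * k * (r - P)\<close> and \<open>P \<le> r\<close>.\<close>

lemma P_ratio_mono:
  assumes "t \<ge> 0"
  shows "P 0 / r 0 \<le> P t / r t"
proof (rule nondecreasing_from_start[OF _ _ assms])
  fix t :: real assume t: "t \<ge> 0"
  let ?D = "((- V t + W t * Q t) * r t - P t * (- V t * P t / r t)) / (r t * r t)"
  show "((\<lambda>t. P t / r t) has_real_derivative ?D) (at t within {0..})"
    using deriv_P[OF t] deriv_r[OF t d_nz[OF t]] r_pos[OF t] by (intro DERIV_divide) auto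
  have r: "r t > 0" and g: "r t - k * P t > 0" using r_pos[OF t] gap[OF d_nz[OF t]] .
  have "W t * Q t * r t = \<kappa>r * (Q t)\<^sup>2 * (1 / k)"
    using r by (simp add: W_eq d_nz t power2_eq_square)
  moreover have "V t * (Q t)\<^sup>2 / r t = \<kappa>r * (Q t)\<^sup>2 * ((P t - k * r t) / (r t - k * P t))"
    using r by (simp add: V_eq d_nz t)
  moreover have "(- V t + W t * Q t) * r t - P t * (- V t * P t / r t)
      = W t * Q t * r t - V t * (Q t)\<^sup>2 / r t"
  proof -
    have "(r t)\<^sup>2 - (P t)\<^sup>2 = (Q t)\<^sup>2"
      using PQ[of t] by linarith
    then have "V t * (Q t)\<^sup>2 / r t = V t * ((r t)\<^sup>2 - (P t)\<^sup>2) / r t"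
      by (simp only:)
    also have "\<dots> = V t * r t - V t * P t * P t / r t"
      using r by (simp add: field_simps power2_eq_square)
    finally show ?thesis
      by (simp add: algebra_simps)
  qed
  ultimately have eq: "(- V t + W t * Q t) * r t - P t * (- V t * P t / r t)
      = \<kappa>r * (Q t)\<^sup>2 * (1 / k - (P t - k * r t) / (r t - k * P t))"
    by (simp only: right_diff_distrib)
  have "k * P t \<le> k * r t"
    using abs_heading_inner_le[of "\<theta> t" "d t"] k by (simp add: P_def r_def)
  moreover have "0 \<le> r t * (1 - k)\<^sup>2" using r by simp
  ultimately have "0 \<le> r t * (1 - k)\<^sup>2 + 2 * (k * r t - k * P t)" by simp
  also have "\<dots> = r t - k * P t - k * (P t - k * r t)" by algebra
  finally have "k * (P t - k * r t) \<le> r t - k * P t" by simp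
  then have "(P t - k * r t) / (r t - k * P t) \<le> 1 / k"
    using k g by (subst pos_divide_le_eq) (simp_all add: pos_le_divide_eq[OF k(1)] mult.commute[of _ k])
  then have "\<kappa>r * (Q t)\<^sup>2 * (1 / k - (P t - k * r t) / (r t - k * P t)) \<ge> 0"
    using kr by (intro mult_nonneg_nonneg) auto
  then show "?D \<ge> 0" unfolding eq by simp
qed

lemma deriv_d_inner:
  "t \<ge> 0 \<Longrightarrow> ((\<lambda>t. a \<bullet> d t) has_real_derivative - V t * (a \<bullet> heading (\<theta> t))) (at t within {0..})"
  using has_vector_derivative_inner[OF has_vector_derivative_const deriv_d, of t a] by simp

text \<open>The speed and the component of the heading along \<open>e\<close> share the factor
  \<open>P - k * r\<close>, so their product contains its square: motion in either direction makes
  progress along the tangent.\<close>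

lemma along_tangent_antimono:
  assumes "t \<ge> 0"
  shows "d t \<bullet> e 0 \<le> d 0 \<bullet> e 0"
proof -
  have "(- e 0) \<bullet> d 0 \<le> (- e 0) \<bullet> d t"
  proof (rule nondecreasing_from_start[OF deriv_d_inner _ assms])
    fix t :: real assume t: "t \<ge> 0"
    have r: "r t > 0" and g: "r t - k * P t > 0" using r_pos[OF t] gap[OF d_nz[OF t]] .
    have "heading (\<theta> t) \<bullet> e t = P t - k * r t"
      by (simp add: e_def headway_error_inner P_def r_def)
    then have "- V t * (- e 0 \<bullet> heading (\<theta> t)) = V t * (exp (\<kappa>r * t) * (P t - k * r t))"
      by (simp add: e0_eq[OF t] inner_commute)
    also have "\<dots> = exp (\<kappa>r * t) * (\<kappa>r * r t * (P t - k * r t)\<^sup>2 / (r t - k * P t))"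
      by (simp add: V_eq d_nz t power2_eq_square)
    also have "\<dots> \<ge> 0" using r g kr by simp
    finally show "- V t * (- e 0 \<bullet> heading (\<theta> t)) \<ge> 0" .
  qed
  then show ?thesis by (simp add: inner_commute)
qed

lemma mem_big:
  assumes t: "t \<ge> 0"
  shows "x t \<in> convex hull {xs, projected_position k xs (x 0) (\<theta> 0), extended_position k xs (x 0) (\<theta> 0)}"
proof -
  let ?L = "exp (\<kappa>r * t)"
  have e: "e t = headway_error k (d t) (\<theta> t)" by (simp add: e_def)
  have r: "r t > 0" and g: "r t - k * P t > 0" using r_pos[OF t] gap[OF d_nz[OF t]] .
  have de: "d t \<bullet> e t = r t * (r t - k * P t)"
    by (simp add: e inner_commute[of "d t"] headway_error_inner r_def P_def)
  have ce: "cross2 (d t) (e 0) = ?L * (k * r t * Q t)"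
  proof -
    have "cross2 (d t) (e 0) = ?L * cross2 (d t) (e t)"
      by (simp add: e0_eq[OF t] cross2_def algebra_simps)
    then show ?thesis by (simp add: e headway_error_cross r_def Q_def)
  qed
  obtain c where c: "c > 0" "Q t = c * Q 0" using Q_proportional[OF t] by blast
  have "xs - d t \<in> convex hull {xs, projected_position k xs (x 0) (\<theta> 0), extended_position k xs (x 0) (\<theta> 0)}"
  proof (rule mem_big_triangle[OF k off_goal, of "d t" "\<theta> 0", folded d_def, folded e_def, folded Q_def])
    show "0 \<le> d t \<bullet> e 0"
      using r g by (simp add: e0_eq[OF t] de)
    show "d t \<bullet> e 0 \<le> d 0 \<bullet> e 0" by (rule along_tangent_antimono[OF t])
    show "0 \<le> (if 0 \<le> Q 0 then 1 else - 1) * cross2 (d t) (e 0)"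
      using r k c by (auto simp: ce mult_nonneg_nonpos mult_pos_neg intro!: mult_nonneg_nonneg mult_nonneg_nonpos)
    \<comment> \<open>The cone condition holds at time \<open>t\<close> relative to
      \<open>e t\<close>; it is homogeneous in that vector and so carries over to
      \<open>e 0\<close>.\<close>
    have "(cross2 (d t) (e t))\<^sup>2 * (1 - k\<^sup>2) \<le> k\<^sup>2 * (d t \<bullet> e t)\<^sup>2"
      unfolding e by (rule headway_error_cone[OF k(2,1)])
    then have "?L\<^sup>2 * ((cross2 (d t) (e t))\<^sup>2 * (1 - k\<^sup>2)) \<le> ?L\<^sup>2 * (k\<^sup>2 * (d t \<bullet> e t)\<^sup>2)"
      by (intro mult_left_mono) auto
    moreover have "cross2 (d t) (e 0) = ?L * cross2 (d t) (e t)" "d t \<bullet> e 0 = ?L * (d t \<bullet> e t)"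
      by (simp_all add: e0_eq[OF t] cross2_def algebra_simps)
    ultimately show "(cross2 (d t) (e 0))\<^sup>2 * (1 - k\<^sup>2) \<le> k\<^sup>2 * (d t \<bullet> e 0)\<^sup>2"
      by (simp add: power_mult_distrib mult_ac)
  qed
  then show ?thesis by (simp add: d_def)
qed

section \<open>Starts at or within the critical angle: confinement to the smaller triangle\<close>

context
  assumes acute: "k * r 0 \<le> P 0"
begin

lemma P_ge:
  assumes t: "t \<ge> 0"
  shows "k * r t \<le> P t"
proof -
  have "k \<le> P 0 / r 0" using acute r_pos[of 0] by (simp add: pos_le_divide_eq)
  also have "\<dots> \<le> P t / r t" by (rule P_ratio_mono[OF t])
  finally show ?thesis using r_pos[OF t] by (simp add: pos_le_divide_eq)
qed

text \<open>The three conditions of \<open>mem_triangle_cross2\<close> with edges \<open>d 0\<close>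
  and \<open>e 0\<close> come from the constant sign of \<open>Q\<close>, the shrinking angle
  between \<open>d\<close> and \<open>e\<close>, and a half-plane bound for the side through
  \<open>x 0\<close> and the headway point.\<close>

lemma mem_small:
  assumes t: "t \<ge> 0"
  shows "x t \<in> convex hull {xs, x 0, headway_point k xs (x 0) (\<theta> 0)}" (is "_ \<in> ?T")
proof (cases "Q 0 = 0")
  case True
  \<comment> \<open>For \<open>Q 0 = 0\<close> the triangle degenerates to a segment and cross
    products say nothing; the unicycle faces the goal throughout and drives straight to it.\<close>
  have straight: "e \<tau> = (1 - k) *\<^sub>R d \<tau>" if \<tau>: "\<tau> \<ge> 0" for \<tau>
  proof -
    have "Q \<tau> = 0" using Q_proportional[OF \<tau>] True by auto
    then have "(P \<tau>)\<^sup>2 = (r \<tau>)\<^sup>2" using PQ[of \<tau>] by simp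
    moreover have "P \<tau> \<ge> 0"
      using P_ge[OF \<tau>] mult_pos_pos[OF k(1) r_pos[OF \<tau>]] by linarith
    ultimately have "P \<tau> = r \<tau>" using r_pos[OF \<tau>] by (simp add: power2_eq_iff_nonneg)
    then have "d \<tau> = r \<tau> *\<^sub>R heading (\<theta> \<tau>)"
      using heading_decomp[of "d \<tau>" "\<theta> \<tau>"] \<open>Q \<tau> = 0\<close> by (simp add: P_def Q_def)
    moreover have "e \<tau> = d \<tau> - k *\<^sub>R (r \<tau> *\<^sub>R heading (\<theta> \<tau>))"
      by (simp add: e_def headway_error_def r_def)
    ultimately show ?thesis by (simp add: scaleR_left_diff_distrib left_diff_distrib)
  qed
  define l where "l = exp (- \<kappa>r * t)"
  have l: "0 \<le> l" "l \<le> 1" using kr t by (simp_all add: l_def)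
  have "(1 - k) *\<^sub>R d t = (1 - k) *\<^sub>R l *\<^sub>R d 0"
    using e_eq[OF t] straight[OF t] straight[of 0] by (simp add: l_def mult.commute)
  then have "d t = l *\<^sub>R d 0" using k by (simp only: scaleR_cancel_left) simp
  then have "x t = (1 - l) *\<^sub>R xs + l *\<^sub>R x 0"
    by (simp add: d_def algebra_simps)
  then show ?thesis
    using l convexD[OF convex_convex_hull, of xs "{xs, x 0, headway_point k xs (x 0) (\<theta> 0)}" "x 0" "1 - l" l]
    by (simp add: hull_inc)
next
  case False
  define \<sigma> :: real where "\<sigma> = (if Q 0 \<ge> 0 then 1 else - 1)"
  have \<sigma>0: "\<sigma> * Q 0 > 0" using False by (simp add: \<sigma>_def)
  have sin_nonneg: "\<sigma> * Q \<tau> / r \<tau> \<ge> 0" if \<tau>: "\<tau> \<ge> 0" for \<tau>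
  proof -
    obtain c where "c > 0" "Q \<tau> = c * Q 0" using Q_proportional[OF \<tau>] by blast
    moreover have "0 \<le> c * (\<sigma> * Q 0) / r \<tau>"
      using \<open>c > 0\<close> \<sigma>0 r_pos[OF \<tau>] by simp
    ultimately show ?thesis by (simp only: mult.left_commute)
  qed
  have unit: "(\<sigma> * Q \<tau> / r \<tau>)\<^sup>2 = 1 - (P \<tau> / r \<tau>)\<^sup>2" if "\<tau> \<ge> 0" for \<tau>
    using PQ[of \<tau>] r_pos[OF that] by (simp add: \<sigma>_def power_divide field_simps)
  have cos_le: "P \<tau> / r \<tau> \<le> 1" if "\<tau> \<ge> 0" for \<tau>
    using abs_heading_inner_le[of "\<theta> \<tau>" "d \<tau>"] r_pos[OF that] by (simp add: P_def r_def)
  have start: "k \<le> P 0 / r 0" using acute r_pos[of 0] by (simp add: pos_le_divide_eq)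

  \<comment> \<open>Both come from \<open>sine_ratio_le\<close> with sine
    \<open>\<sigma> * Q / r\<close> and cosine \<open>P / r\<close>. Cleared of denominators, they
    say that the angles from \<open>e\<close> to \<open>d\<close> and from \<open>e\<close> to the
    heading, with tangents \<open>k * Q / (r - k * P)\<close> and \<open>Q / (P - k * r)\<close> up
    to sign, do not exceed their initial values.\<close>
  have inward: "\<sigma> * Q \<tau> * (r 0 - k * P 0) \<le> \<sigma> * Q 0 * (r \<tau> - k * P \<tau>)"
    and turning: "\<sigma> * Q \<tau> * (P 0 - k * r 0) \<le> \<sigma> * Q 0 * (P \<tau> - k * r \<tau>)" if \<tau>: "\<tau> \<ge> 0" for \<tau>
  proof -
    have r: "r 0 > 0" "r \<tau> > 0" using r_pos \<tau> by auto
    note ineq = sine_ratio_le[OF k start P_ratio_mono[OF \<tau>] cos_le[OF \<tau>] unit[OF \<tau>] unit[of 0]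
        sin_nonneg[OF \<tau>] sin_nonneg[of 0], simplified]
    have "\<sigma> * Q \<tau> * (r 0 - k * P 0)
        = (\<sigma> * Q \<tau> / r \<tau> * (1 - k * (P 0 / r 0))) * (r 0 * r \<tau>)"
      using r by (simp add: field_simps)
    also have "\<dots> \<le> (\<sigma> * Q 0 / r 0 * (1 - k * (P \<tau> / r \<tau>))) * (r 0 * r \<tau>)"
      using ineq(1) r by (intro mult_right_mono) auto
    also have "\<dots> = \<sigma> * Q 0 * (r \<tau> - k * P \<tau>)"
      using r by (simp add: field_simps)
    finally show "\<sigma> * Q \<tau> * (r 0 - k * P 0) \<le> \<sigma> * Q 0 * (r \<tau> - k * P \<tau>)" .
    have "\<sigma> * Q \<tau> * (P 0 - k * r 0)
        = (\<sigma> * Q \<tau> / r \<tau> * (P 0 / r 0 - k)) * (r 0 * r \<tau>)"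
      using r by (simp add: field_simps)
    also have "\<dots> \<le> (\<sigma> * Q 0 / r 0 * (P \<tau> / r \<tau> - k)) * (r 0 * r \<tau>)"
      using ineq(2) sin_nonneg[OF \<tau>] sin_nonneg[of 0] start P_ratio_mono[OF \<tau>] r
      by (intro mult_right_mono mult_mono) auto
    also have "\<dots> = \<sigma> * Q 0 * (P \<tau> - k * r \<tau>)"
      using r by (simp add: field_simps)
    finally show "\<sigma> * Q \<tau> * (P 0 - k * r 0) \<le> \<sigma> * Q 0 * (P \<tau> - k * r \<tau>)" .
  qed

  have d0e0: "cross2 (d 0) (e 0) = k * r 0 * Q 0" "d 0 \<bullet> e 0 = r 0 * (r 0 - k * P 0)"
    "heading (\<theta> 0) \<bullet> e 0 = P 0 - k * r 0" "cross2 (heading (\<theta> 0)) (e 0) = Q 0"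
    by (simp_all add: e_def headway_error_cross headway_error_inner inner_commute[of "d 0"]
        r_def P_def Q_def)
  have dte0: "cross2 (d \<tau>) (e 0) = exp (\<kappa>r * \<tau>) * (k * r \<tau> * Q \<tau>)"
    "e 0 \<bullet> d \<tau> = exp (\<kappa>r * \<tau>) * (r \<tau> * (r \<tau> - k * P \<tau>))"
    "e 0 \<bullet> heading (\<theta> \<tau>) = exp (\<kappa>r * \<tau>) * (P \<tau> - k * r \<tau>)"
    "cross2 (heading (\<theta> \<tau>)) (e 0) = exp (\<kappa>r * \<tau>) * Q \<tau>" if "\<tau> \<ge> 0" for \<tau>
  proof -
    have scale: "cross2 a (e 0) = exp (\<kappa>r * \<tau>) * cross2 a (e \<tau>)"
      "e 0 \<bullet> a = exp (\<kappa>r * \<tau>) * (e \<tau> \<bullet> a)" for a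
      by (simp_all add: e0_eq[OF that] cross2_def algebra_simps)
    show "cross2 (d \<tau>) (e 0) = exp (\<kappa>r * \<tau>) * (k * r \<tau> * Q \<tau>)"
      "e 0 \<bullet> d \<tau> = exp (\<kappa>r * \<tau>) * (r \<tau> * (r \<tau> - k * P \<tau>))"
      "e 0 \<bullet> heading (\<theta> \<tau>) = exp (\<kappa>r * \<tau>) * (P \<tau> - k * r \<tau>)"
      "cross2 (heading (\<theta> \<tau>)) (e 0) = exp (\<kappa>r * \<tau>) * Q \<tau>"
      unfolding scale
      by (simp_all add: e_def headway_error_cross headway_error_inner r_def P_def Q_def
          inner_commute[of _ "heading _"])
  qed
  have e0: "(norm (e 0))\<^sup>2 > 0"
    using headway_error_eq_0_iff[OF k] d_nz[of 0] by (simp add: e_def)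

  \<comment> \<open>The directions of \<open>d\<close> at the two times are compared through the
    fixed direction \<open>e 0\<close>.\<close>
  have "\<sigma> * cross2 (d 0) (d t) * (norm (e 0))\<^sup>2
      = \<sigma> * (cross2 (d 0) (e 0) * (e 0 \<bullet> d t) - (d 0 \<bullet> e 0) * cross2 (d t) (e 0))"
    by (simp add: cross2_lagrange mult.assoc)
  also have "\<dots> = exp (\<kappa>r * t) * (k * r 0 * r t)
      * (\<sigma> * Q 0 * (r t - k * P t) - \<sigma> * Q t * (r 0 - k * P 0))"
    unfolding d0e0 dte0[OF t] by (simp add: algebra_simps)
  also have "\<dots> \<ge> 0"
    using inward[OF t] r_pos[OF t] r_pos[of 0] k by simp
  finally have angle: "\<sigma> * cross2 (d 0) (d t) \<ge> 0"
    using e0 by (simp add: zero_le_mult_iff)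

  have rotate: "\<sigma> * (heading_normal (\<theta> 0) \<bullet> heading (\<theta> \<tau>)) \<ge> 0" if \<tau>: "\<tau> \<ge> 0" for \<tau>
  proof -
    have "heading_normal (\<theta> 0) \<bullet> heading (\<theta> \<tau>) = cross2 (heading (\<theta> 0)) (heading (\<theta> \<tau>))"
      by (simp add: cross2_def inner_vec2)
    then have "\<sigma> * (heading_normal (\<theta> 0) \<bullet> heading (\<theta> \<tau>)) * (norm (e 0))\<^sup>2
        = \<sigma> * (cross2 (heading (\<theta> 0)) (e 0) * (e 0 \<bullet> heading (\<theta> \<tau>))
          - (heading (\<theta> 0) \<bullet> e 0) * cross2 (heading (\<theta> \<tau>)) (e 0))"
      by (simp add: cross2_lagrange mult.assoc)
    also have "\<dots> = exp (\<kappa>r * \<tau>) * (\<sigma> * Q 0 * (P \<tau> - k * r \<tau>) - \<sigma> * Q \<tau> * (P 0 - k * r 0))"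
      unfolding d0e0 dte0[OF \<tau>] by (simp add: algebra_simps)
    also have "\<dots> \<ge> 0"
      using turning[OF \<tau>] by simp
    finally show ?thesis
      using e0 by (simp add: zero_le_mult_iff)
  qed
  \<comment> \<open>A nonnegative speed along headings turned towards the tangent keeps the position
    on the goal's side of the line through \<open>x 0\<close> with direction
    \<open>heading (\<theta> 0)\<close>.\<close>
  have "(- \<sigma> *\<^sub>R heading_normal (\<theta> 0)) \<bullet> d 0 \<le> (- \<sigma> *\<^sub>R heading_normal (\<theta> 0)) \<bullet> d t"
  proof (rule nondecreasing_from_start[OF deriv_d_inner _ t])
    fix \<tau> :: real assume \<tau>: "\<tau> \<ge> 0"
    have "V \<tau> \<ge> 0"
      using P_ge[OF \<tau>] r_pos[OF \<tau>] gap[OF d_nz[OF \<tau>]] kr by (simp add: V_eq d_nz \<tau>)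
    then have "V \<tau> * (\<sigma> * (heading_normal (\<theta> 0) \<bullet> heading (\<theta> \<tau>))) \<ge> 0"
      using rotate[OF \<tau>] by simp
    then show "- V \<tau> * (- \<sigma> *\<^sub>R heading_normal (\<theta> 0) \<bullet> heading (\<theta> \<tau>)) \<ge> 0"
      by simp
  qed
  then have "\<sigma> * (heading_normal (\<theta> 0) \<bullet> d t) \<le> \<sigma> * Q 0"
    by (simp add: Q_def)
  then have half: "k * r 0 * (\<sigma> * (heading_normal (\<theta> 0) \<bullet> d t)) \<le> k * r 0 * (\<sigma> * Q 0)"
    using k r_pos[of 0] by (intro mult_left_mono[where c = "k * r 0"]) auto
  \<comment> \<open>The sum is the cross product of \<open>d t\<close> with
    \<open>e 0 - d 0\<close>, a multiple of the initial heading; this turns the last triangle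
    condition into the half-plane bound.\<close>
  have sum: "cross2 (d t) (e 0) + cross2 (d 0) (d t) = k * r 0 * (heading_normal (\<theta> 0) \<bullet> d t)"
    by (simp add: e_def headway_error_def r_def cross2_def inner_vec2 algebra_simps)

  have "xs - d t \<in> convex hull {xs, xs - d 0, xs - e 0}"
  proof (rule mem_triangle_cross2[where \<sigma> = \<sigma>])
    have "k * r 0 * (\<sigma> * Q 0) > 0"
      using k r_pos[of 0] \<sigma>0 by simp
    then show "\<sigma> * cross2 (d 0) (e 0) > 0"
      by (simp only: d0e0 mult.left_commute)
    have "\<sigma> * cross2 (d t) (e 0) = exp (\<kappa>r * t) * (k * r t * r t * (\<sigma> * Q t / r t))"
      using r_pos[OF t] by (simp add: dte0 t)
    then show "\<sigma> * cross2 (d t) (e 0) \<ge> 0"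
      using sin_nonneg[OF t] k r_pos[OF t] by (simp only:) (intro mult_nonneg_nonneg; simp)
    show "\<sigma> * (cross2 (d t) (e 0) + cross2 (d 0) (d t)) \<le> \<sigma> * cross2 (d 0) (e 0)"
      using half by (simp add: sum d0e0 mult.left_commute)
  qed (rule angle)
  moreover have "xs - e 0 = headway_point k xs (x 0) (\<theta> 0)"
    by (simp add: e_def d_def flip: diff_headway_point)
  ultimately show ?thesis by (simp add: d_def)
qed

end

end

section \<open>Assembly of the three claims\<close>

theorem lemma7:
  fixes \<kappa>r \<kappa>e :: real and xs :: "real^2"
  assumes "\<kappa>r > 0" and "0 < \<kappa>e" and "\<kappa>e < 1"
  shows
    "(\<forall>x \<theta>. closed_loop_trajectory \<kappa>r \<kappa>e xs x \<theta> \<longrightarrow>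
        (\<forall>t\<ge>0. x t \<in>
           (if heading (\<theta> 0) \<bullet> goal_dir xs (x 0) \<ge> \<kappa>e
            then convex hull {xs, x 0, headway_point \<kappa>e xs (x 0) (\<theta> 0)}
            else convex hull {xs, projected_position \<kappa>e xs (x 0) (\<theta> 0),
                                  extended_position \<kappa>e xs (x 0) (\<theta> 0)}))) \<and>
     (\<forall>x0. \<forall>\<theta>0\<in>{-pi..<pi}. heading \<theta>0 \<bullet> goal_dir xs x0 \<ge> \<kappa>e \<longrightarrow>
        convex hull {xs, x0, headway_point \<kappa>e xs x0 \<theta>0} \<subseteq>
        convex hull {xs, projected_position \<kappa>e xs x0 \<theta>0, extended_position \<kappa>e xs x0 \<theta>0}) \<and>
     (\<forall>x. \<forall>\<theta>\<in>{-pi..<pi}. heading \<theta> \<bullet> goal_dir xs x = \<kappa>e \<longrightarrow>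
        extended_position \<kappa>e xs x \<theta> = x \<and>
        projected_position \<kappa>e xs x \<theta> = headway_point \<kappa>e xs x \<theta>)"
proof (intro conjI allI ballI impI)
  fix x \<theta> and t :: real
  assume traj: "closed_loop_trajectory \<kappa>r \<kappa>e xs x \<theta>" and t: "0 \<le> t"
  interpret closed_loop \<kappa>r \<kappa>e xs x \<theta>
    using assms traj by unfold_locales
  show "x t \<in> (if heading (\<theta> 0) \<bullet> goal_dir xs (x 0) \<ge> \<kappa>e
            then convex hull {xs, x 0, headway_point \<kappa>e xs (x 0) (\<theta> 0)}
            else convex hull {xs, projected_position \<kappa>e xs (x 0) (\<theta> 0),
                                  extended_position \<kappa>e xs (x 0) (\<theta> 0)})"
  proof (cases "x 0 = xs")
    case True
    \<comment> \<open>A start at the goal stays there, and the goal is a vertex of either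
      triangle.\<close>
    then have "x t = xs"
      using d_eq_0_iff_start[OF t] by (simp add: d_eq_0_iff)
    then show ?thesis by (simp add: hull_inc)
  next
    case False
    then interpret closed_loop_off_goal \<kappa>r \<kappa>e xs x \<theta>
      by unfold_locales
    have "k * r 0 \<le> P 0" if "heading (\<theta> 0) \<bullet> goal_dir xs (x 0) \<ge> k" for k
      using that r_pos[of 0] by (simp add: heading_goal_dir P_def r_def d_def field_simps)
    then show ?thesis
      using mem_small[OF _ t] mem_big[OF t] by simp
  qed
qed (use assms small_triangle_subset_big_triangle positions_at_critical_angle in auto)

end
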